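(* Let $q$ be a complex number with $|q|<1$. Then the following three identities hold: \begin{align*} \sum_{i,j,k\ge 0}\frac{q^{i^2+\frac{5}{2}j^2+8k^2+2ij+4ik+8jk-\frac{1}{2}j}}{(q;q)_i(q;q)_j(q^2;q^2)_k} &=\frac{(q^3,q^4,q^7;q^7)_\infty}{(q;q)_\infty},\\ \sum_{i,j,k\ge 0}\frac{q^{i^2+\frac{5}{2}j^2+8k^2+2ij+4ik+8jk+\frac{1}{2}j+2k}}{(q;q)_i(q;q)_j(q^2;q^2)_k} &=\frac{(q^2,q^5,q^7;q^7)_\infty}{(q;q)_\infty},\\ \sum_{i,j,k\ge 0}\frac{q^{i^2+\frac{5}{2}j^2+8k^2+2ij+4ik+8jk+i+\frac{3}{2}j+4k}}{(q;q)_i(q;q)_j(q^2;q^2)_k} &= \frac{(q,q^6,q^7;q^7)_\infty}{(q;q)_\infty}. \end{align*}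
   Context: For $|q|<1$: $(a;q)_\infty=\prod_{m=0}^\infty(1-aq^m)$, $(a;q)_n=(a;q)_\infty/(aq^n;q)_\infty=\prod_{m=0}^{n-1}(1-aq^m)$ for integers $n\ge0$, and $(a_1,\dots,a_r;q)_\infty=(a_1;q)_\infty\cdots(a_r;q)_\infty$; the same notation is used with the base $q$ replaced by a power of $q$. All exponents of $q$ in the sums are integers. *)

theory Defs
  imports "HOL-Analysis.Analysis"
begin

definition qpoch :: "complex \<Rightarrow> complex \<Rightarrow> nat \<Rightarrow> complex" where
  "qpoch a q n = (\<Prod>m<n. 1 - a * q ^ m)"

(* Meaningful for norm q < 1, where the product converges; a product with finitely many
   vanishing factors still counts as convergent for prodinf and has value 0. *)
definition qpoch_inf :: "complex \<Rightarrow> complex \<Rightarrow> complex" where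
  "qpoch_inf a q = (\<Prod>m. 1 - a * q ^ m)"

definition qpochs_inf :: "complex list \<Rightarrow> complex \<Rightarrow> complex" where
  "qpochs_inf as q = (\<Prod>a\<leftarrow>as. qpoch_inf a q)"

(* The half-integral parts of the exponents are integers, so they are written with natural
   number division (and truncated subtraction); the following facts show that nothing is lost. *)
lemma exponent_minus: "real ((5 * j\<^sup>2 - j) div 2) = 5/2 * (real j)\<^sup>2 - 1/2 * real j"
proof -
  have le: "j \<le> 5 * j\<^sup>2" by (cases j) (auto simp: power2_eq_square)
  have "even (5 * j\<^sup>2 - j)" using le by auto
  then have "real ((5 * j\<^sup>2 - j) div 2) = real (5 * j\<^sup>2 - j) / 2"
    by (simp add: real_of_nat_div)
  also have "\<dots> = (5 * (real j)\<^sup>2 - real j) / 2"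
    using le by (simp add: of_nat_diff)
  finally show ?thesis by simp
qed

lemma exponent_plus: "real ((5 * j\<^sup>2 + j) div 2) = 5/2 * (real j)\<^sup>2 + 1/2 * real j"
proof -
  have "even (5 * j\<^sup>2 + j)" by simp
  then have "real ((5 * j\<^sup>2 + j) div 2) = real (5 * j\<^sup>2 + j) / 2"
    by (simp only: real_of_nat_div)
  then show ?thesis by simp
qed

lemma exponent_plus3: "real ((5 * j\<^sup>2 + 3 * j) div 2) = 5/2 * (real j)\<^sup>2 + 3/2 * real j"
proof -
  have "even (5 * j\<^sup>2 + 3 * j)" by simp
  then have "real ((5 * j\<^sup>2 + 3 * j) div 2) = real (5 * j\<^sup>2 + 3 * j) / 2"
    by (simp only: real_of_nat_div)
  then show ?thesis by simp
qed

end

theory Submission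
  imports Defs
begin

text \<open>
The exponents separate after a linear change of variables. With \<open>s = i + j + 2k\<close> and \<open>t = j + 2k\<close> the three exponents
are \<open>s^2 + t^2 + (j choose 2)\<close> plus \<open>0\<close>, \<open>t\<close> and \<open>s + t\<close>. For fixed \<open>s\<close> and \<open>t\<close> only a
finite sum over \<open>j + 2k = t\<close> remains, which equals \<open>1 / (q;q)\<close> with index \<open>t\<close> (\<open>sum_over_j_plus_2k\<close>). The triple sums
are therefore the double sums of \<open>q^(s^2 + t^2 + ...)\<close> divided by \<open>(q;q)\<close> with index \<open>s - t\<close> and \<open>(q;q)\<close> with
index \<open>t\<close>, and the claim becomes the Andrews-Gordon identities modulo 7.

These are proved with a Bailey chain. Starting from the unit Bailey pair (\<open>unit_bailey_pair\<close>),
\<open>bailey_lemma\<close> is applied three times. The first application produces \<open>1 / (q;q)\<close>, the other two add the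
summations over \<open>t\<close> and \<open>s\<close>, and each multiplies the terms of a theta series by \<open>q^(m^2)\<close> or \<open>q^(m^2 + m)\<close> on the other side. The linear terms \<open>t\<close> and
\<open>s + t\<close> require steps with parameter \<open>q\<close> instead of \<open>1\<close>, and \<open>bailey_sum_1_to_0\<close> provides the change between
the two. This gives finite identities, one for each \<open>N\<close>
(\<open>andrews_gordon_sum_eq_bailey_sum\<close>).

As \<open>N\<close> tends to infinity, Tannery's theorem turns them into theta series with \<open>p = q^7\<close>, and
\<open>jacobi_triple_product\<close> writes these as products. The triple product itself is the limit of a
finite identity of the same shape (\<open>finite_jacobi_triple_product_bailey\<close>).
\<close>

section \<open>Triangular exponents, finite products and q-binomial coefficients\<close>

lemma choose_2_Suc: "Suc m choose 2 = (m choose 2) + m"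
  by (simp add: numeral_2_eq_2)

lemma square_eq_choose_2: "m\<^sup>2 = 2 * (m choose 2) + m"
  by (induction m) (simp_all add: choose_2_Suc power2_eq_square)

lemma qpoch_0 [simp]: "qpoch a q 0 = 1"
  by (simp add: qpoch_def)

lemma qpoch_Suc: "qpoch a q (Suc n) = qpoch a q n * (1 - a * q ^ n)"
  by (simp add: qpoch_def)

lemma one_minus_mult_power_nonzero:
  fixes a q :: complex
  assumes "norm a < 1" "norm q < 1"
  shows "1 - a * q ^ n \<noteq> 0"
proof
  assume "1 - a * q ^ n = 0"
  then have "norm (a * q ^ n) = 1" by simp
  moreover have "norm (a * q ^ n) \<le> norm a * 1"
    unfolding norm_mult norm_power
    by (intro mult_left_mono power_le_one) (use assms in auto)
  ultimately show False using assms by simp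
qed

lemma qpoch_nonzero:
  assumes "norm a < 1" "norm q < 1"
  shows "qpoch a q n \<noteq> 0"
  using one_minus_mult_power_nonzero[OF assms] by (simp add: qpoch_def)

lemma power_Suc_neq_1:
  fixes q :: complex
  assumes "norm q < 1" 
  shows "1 - q * q ^ n \<noteq> 0" "1 - q ^ Suc n \<noteq> 0"
  using one_minus_mult_power_nonzero[OF assms assms] by simp_all

definition qbinom :: "complex \<Rightarrow> nat \<Rightarrow> nat \<Rightarrow> complex" where
  "qbinom q n k = (if k \<le> n then qpoch q q n / (qpoch q q k * qpoch q q (n - k)) else 0)"

lemma qbinom_0_right: "norm q < 1 \<Longrightarrow> qbinom q n 0 = 1"
  by (simp add: qbinom_def qpoch_nonzero)

lemma qbinom_eq_0: "n < k \<Longrightarrow> qbinom q n k = 0"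
  by (simp add: qbinom_def)

text \<open>
The two q-Pascal rules. With \<open>n - k = Suc d\<close> they amount to the two ways of splitting the factor
\<open>1 - q^(n+1)\<close> into multiples of \<open>1 - q^(k+1)\<close> and \<open>1 - q^(n-k)\<close>.
\<close>

lemma
  assumes q: "norm q < 1"
  shows qbinom_Suc_Suc: "qbinom q (Suc n) (Suc k) = qbinom q n (Suc k) + q ^ (n - k) * qbinom q n k"
    and qbinom_Suc_Suc': "qbinom q (Suc n) (Suc k) = qbinom q n k + q ^ Suc k * qbinom q n (Suc k)"
proof -
  have "qbinom q (Suc n) (Suc k) = qbinom q n (Suc k) + q ^ (n - k) * qbinom q n k \<and>
        qbinom q (Suc n) (Suc k) = qbinom q n k + q ^ Suc k * qbinom q n (Suc k)"
  proof (cases k n rule: linorder_cases)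
    case less
    then obtain d where n: "n = Suc (k + d)" using less_iff_Suc_add by auto
    define P where "P = qpoch q q"
    have nz: "P i \<noteq> 0" for i using qpoch_nonzero[OF q q] by (simp add: P_def)
    have rec: "P (Suc i) = P i * (1 - q * q ^ i)" for i by (simp add: P_def qpoch_Suc)
    note nz1 = power_Suc_neq_1(1)[OF q]
    have S: "qbinom q (Suc n) (Suc k) = P (k + d) * (1 - q * q ^ (k + d)) * (1 - q * q ^ Suc (k + d)) / (P k * (1 - q * q ^ k) * (P d * (1 - q * q ^ d)))"
      unfolding qbinom_def n P_def[symmetric] by (simp add: rec)
    have A: "qbinom q n (Suc k) = P (k + d) * (1 - q * q ^ (k + d)) / (P k * (1 - q * q ^ k) * P d)"
      unfolding qbinom_def n P_def[symmetric] by (simp add: rec)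
    have B: "qbinom q n k = P (k + d) * (1 - q * q ^ (k + d)) / (P k * (P d * (1 - q * q ^ d)))"
      unfolding qbinom_def n P_def[symmetric] by (simp add: rec Suc_diff_le)
    have split: "1 - q * q ^ Suc (k + d) = (1 - q * q ^ d) + q ^ Suc d * (1 - q * q ^ k)"
      "1 - q * q ^ Suc (k + d) = (1 - q * q ^ k) + q ^ Suc k * (1 - q * q ^ d)"
      by (simp_all add: power_add algebra_simps)
    have frac: "X * U * c / (K * a * (L * b)) = X * U / (K * a * L) + y * (X * U / (K * (L * b)))"
      if "c = b + y * a" "a \<noteq> 0" "b \<noteq> 0" for X U a b c y K L :: complex
      using that(2,3) unfolding that(1) by (simp add: add_divide_distrib distrib_left mult_ac)
    have frac': "X * U * c / (K * a * (L * b)) = X * U / (K * (L * b)) + y * (X * U / (K * a * L))"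
      if "c = a + y * b" "a \<noteq> 0" "b \<noteq> 0" for X U a b c y K L :: complex
      using that(2,3) unfolding that(1) by (simp add: add_divide_distrib distrib_left mult_ac)
    have nk: "n - k = Suc d" using n by simp
    show ?thesis unfolding S A B nk
      by (intro conjI frac frac' split nz1)
  next
    case equal
    then show ?thesis using qpoch_nonzero[OF q q] by (simp add: qbinom_def)
  next
    case greater
    then show ?thesis by (simp add: qbinom_def)
  qed
  then show "qbinom q (Suc n) (Suc k) = qbinom q n (Suc k) + q ^ (n - k) * qbinom q n k"
    and "qbinom q (Suc n) (Suc k) = qbinom q n k + q ^ Suc k * qbinom q n (Suc k)" by auto
qed

text \<open>
Splitting off the term \<open>k = 0\<close> keeps the upper limit, since the new last coefficient is zero; in this
form the q-Pascal rules can be applied under the sum.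
\<close>

lemma sum_qbinom_shift:
  assumes "norm q < 1"
  shows "(\<Sum>k\<le>n. qbinom q n k * f k) = f 0 + (\<Sum>k\<le>n. qbinom q n (Suc k) * f (Suc k))"
proof -
  have "(\<Sum>k\<le>n. qbinom q n k * f k) = (\<Sum>k\<le>Suc n. qbinom q n k * f k)"
    by (simp add: qbinom_eq_0)
  also have "\<dots> = f 0 + (\<Sum>k\<le>n. qbinom q n (Suc k) * f (Suc k))"
    using assms by (simp only: sum.atMost_Suc_shift qbinom_0_right mult_1)
  finally show ?thesis .
qed

text \<open>
The limit for \<open>M\<close> to infinity of the q-Chu-Vandermonde sum
\<open>\<Sum> [n, t] [M, t + b] q^(t (t + b)) = [M + n, n + b]\<close> of q-binomial coefficients. Induction on \<open>n\<close>: the first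
q-Pascal rule splits the sum into the same sum for \<open>(n, b)\<close> and, after a shift of \<open>t\<close>, a multiple
\<open>q^(n+b+1)\<close> of the sum for \<open>(n, b + 1)\<close>, which explains why \<open>b\<close> is generalised.
\<close>

lemma q_vandermonde:
  assumes q: "norm q < 1"
  shows "(\<Sum>t\<le>n. qbinom q n t * (q ^ (t\<^sup>2 + b * t) / qpoch q q (t + b))) = 1 / qpoch q q (n + b)"
proof (induction n arbitrary: b)
  case 0
  then show ?case using q by (simp add: qbinom_0_right)
next
  case (Suc n)
  define f where "f = (\<lambda>t. q ^ (t\<^sup>2 + b * t) / qpoch q q (t + b))"
  have f: "q ^ (n - t) * f (Suc t) = q ^ Suc (n + b) * (q ^ (t\<^sup>2 + Suc b * t) / qpoch q q (t + Suc b))"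
    if tn: "t \<le> n" for t
  proof -
    have "n - t + ((Suc t)\<^sup>2 + b * Suc t) = Suc (n + b) + (t\<^sup>2 + Suc b * t)"
    proof -
      obtain d where n: "n = t + d" using tn by (auto simp: le_iff_add)
      show ?thesis unfolding n by (simp add: power2_eq_square distrib_left)
    qed
    moreover have "Suc t + b = t + Suc b" by simp
    ultimately show ?thesis unfolding f_def times_divide_eq_right power_add[symmetric] by (simp only:)
  qed
  have "(\<Sum>t\<le>Suc n. qbinom q (Suc n) t * f t)
      = f 0 + (\<Sum>t\<le>n. qbinom q (Suc n) (Suc t) * f (Suc t))"
    using q by (simp only: sum.atMost_Suc_shift qbinom_0_right mult_1)
  also have "\<dots> = (f 0 + (\<Sum>t\<le>n. qbinom q n (Suc t) * f (Suc t)))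
                 + (\<Sum>t\<le>n. qbinom q n t * (q ^ (n - t) * f (Suc t)))"
    unfolding qbinom_Suc_Suc[OF q] by (simp add: sum.distrib distrib_right mult.assoc mult.left_commute)
  also have "f 0 + (\<Sum>t\<le>n. qbinom q n (Suc t) * f (Suc t)) = 1 / qpoch q q (n + b)"
    unfolding sum_qbinom_shift[OF q, where f = f, symmetric] unfolding f_def by (rule Suc)
  also have "(\<Sum>t\<le>n. qbinom q n t * (q ^ (n - t) * f (Suc t)))
      = q ^ Suc (n + b) * (\<Sum>t\<le>n. qbinom q n t * (q ^ (t\<^sup>2 + Suc b * t) / qpoch q q (t + Suc b)))"
    unfolding sum_distrib_left
    by (rule sum.cong[OF refl]) (subst mult.left_commute[of "q ^ Suc (n + b)"], subst f, auto)
  also have "\<dots> = q ^ Suc (n + b) / qpoch q q (Suc (n + b))"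
    unfolding Suc[of "Suc b"] by simp
  also have "1 / qpoch q q (n + b) + q ^ Suc (n + b) / qpoch q q (Suc (n + b)) = 1 / qpoch q q (Suc n + b)"
    using qpoch_nonzero[OF q q, of "n + b"] power_Suc_neq_1[OF q, of "n + b"]
    by (simp add: qpoch_Suc divide_simps)
  finally show ?case unfolding f_def .
qed

section \<open>Bailey pairs\<close>

text \<open>
The sequence \<open>\<beta>\<close> of a Bailey pair \<open>(\<alpha>, \<beta>)\<close> relative to the parameter \<open>q^a\<close>. Writing the second factor as
\<open>(q;q)\<close> with index \<open>n + m + a\<close> rescales the usual normalisation by \<open>(q;q)\<close> with index \<open>a\<close>, and makes the
cases \<open>a = 0\<close> and \<open>a = 1\<close> uniform.
\<close>

definition bailey_sum :: "complex \<Rightarrow> nat \<Rightarrow> (nat \<Rightarrow> complex) \<Rightarrow> nat \<Rightarrow> complex" where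
  "bailey_sum q a \<alpha> n = (\<Sum>m\<le>n. \<alpha> m / (qpoch q q (n - m) * qpoch q q (n + m + a)))"

lemma sum_triangle_shift:
  fixes f :: "nat \<Rightarrow> nat \<Rightarrow> 'a :: comm_monoid_add"
  shows "(\<Sum>s\<le>n. \<Sum>m\<le>s. f s m) = (\<Sum>m\<le>n. \<Sum>t\<le>n - m. f (m + t) m)"
  unfolding sum.Sigma[OF finite_atMost ballI[OF finite_atMost]]
  by (rule sum.reindex_bij_witness[of _ "\<lambda>(m, t). (m + t, m)" "\<lambda>(s, m). (m, s - m)"]) auto

text \<open>
One step along a Bailey chain: weighting \<open>\<alpha>\<close> by \<open>q^(m^2 + a m)\<close> corresponds to one further q-weighted
summation of \<open>\<beta>\<close>. After exchanging the sums, the inner sum for fixed \<open>m\<close> is the q-Vandermonde sum with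
\<open>n = N - m\<close> and \<open>b = 2 m + a\<close>.
\<close>

lemma bailey_lemma:
  assumes q: "norm q < 1"
  shows "(\<Sum>s\<le>N. q ^ (s\<^sup>2 + a * s) / qpoch q q (N - s) * bailey_sum q a \<alpha> s)
       = bailey_sum q a (\<lambda>m. q ^ (m\<^sup>2 + a * m) * \<alpha> m) N"
proof -
  note nz = qpoch_nonzero[OF q q]
  have "(\<Sum>s\<le>N. q ^ (s\<^sup>2 + a * s) / qpoch q q (N - s) * bailey_sum q a \<alpha> s)
      = (\<Sum>s\<le>N. \<Sum>m\<le>s. q ^ (s\<^sup>2 + a * s) / qpoch q q (N - s) *
            (\<alpha> m / (qpoch q q (s - m) * qpoch q q (s + m + a))))"
    unfolding bailey_sum_def sum_distrib_left ..
  also have "\<dots> = (\<Sum>m\<le>N. \<Sum>t\<le>N - m. q ^ ((m + t)\<^sup>2 + a * (m + t)) / qpoch q q (N - (m + t)) *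
            (\<alpha> m / (qpoch q q (m + t - m) * qpoch q q (m + t + m + a))))"
    by (rule sum_triangle_shift)
  also have "\<dots> = (\<Sum>m\<le>N. q ^ (m\<^sup>2 + a * m) * \<alpha> m / (qpoch q q (N - m) * qpoch q q (N + m + a)))"
  proof (rule sum.cong[OF refl], goal_cases)
    case (1 m)
    then have m: "m \<le> N" by simp
    have "(\<Sum>t\<le>N - m. q ^ ((m + t)\<^sup>2 + a * (m + t)) / qpoch q q (N - (m + t)) *
            (\<alpha> m / (qpoch q q (m + t - m) * qpoch q q (m + t + m + a))))
        = q ^ (m\<^sup>2 + a * m) * \<alpha> m / qpoch q q (N - m) *
          (\<Sum>t\<le>N - m. qbinom q (N - m) t * (q ^ (t\<^sup>2 + (2 * m + a) * t) / qpoch q q (t + (2 * m + a))))"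
      unfolding sum_distrib_left
    proof (rule sum.cong[OF refl], goal_cases)
      case (1 t)
      have e: "(m + t)\<^sup>2 + a * (m + t) = (m\<^sup>2 + a * m) + (t\<^sup>2 + (2 * m + a) * t)"
        by (simp add: power2_eq_square algebra_simps)
      have e': "m + t + m + a = t + (2 * m + a)" "m + t - m = t" "N - (m + t) = N - m - t" by simp_all
      define D where "D = qpoch q q (t + (2 * m + a))"
      show ?case using 1 nz[of "N - m"] unfolding e e' power_add qbinom_def D_def[symmetric]
        by (simp add: mult_ac)
    qed
    also have "\<dots> = q ^ (m\<^sup>2 + a * m) * \<alpha> m / qpoch q q (N - m) * (1 / qpoch q q (N - m + (2 * m + a)))"
      by (simp only: q_vandermonde[OF q])
    also have "N - m + (2 * m + a) = N + m + a" using m by simp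
    finally show ?case by simp
  qed
  finally show ?thesis unfolding bailey_sum_def .
qed

text \<open>
The passage from parameter \<open>q\<close> to parameter \<open>1\<close> rests on
\<open>1 - q^(2m+1) = (1 - q^(N+m+1)) - q^(2m+1) (1 - q^(N-m))\<close>: each difference cancels one factor of the
denominator, so a term splits into a term at \<open>m\<close> and a term at \<open>m + 1\<close> of a sum with parameter \<open>1\<close>.
\<close>

lemma bailey_sum_1_to_0:
  assumes q: "norm q < 1"
  shows "bailey_sum q 1 (\<lambda>m. (1 - q ^ (2 * m + 1)) * w m) N
       = bailey_sum q 0 (\<lambda>m. w m - (if m = 0 then 0 else q ^ (2 * m - 1) * w (m - 1))) N"
proof -
  note nz = qpoch_nonzero[OF q q]
  define v where "v = (\<lambda>m. q ^ (2 * m + 1) * w m)"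
  \<comment> \<open>The convention \<open>c (N + 1) = 0\<close> matches the vanishing of \<open>1 - q^(N-m)\<close> at \<open>m = N\<close>.\<close>
  define c where "c = (\<lambda>m. if m \<le> N then 1 / (qpoch q q (N - m) * qpoch q q (N + m)) else 0)"
  have "(1 - q ^ (2 * m + 1)) * w m / (qpoch q q (N - m) * qpoch q q (N + m + 1))
      = w m * c m - v m * c (Suc m)" if "m \<le> N" for m
  proof (cases "m = N")
    case True
    have "1 - q * q ^ (N + N) \<noteq> 0" by (rule power_Suc_neq_1[OF q])
    then show ?thesis using nz[of "N + N"]
      unfolding True by (simp add: c_def qpoch_Suc mult_2)
  next
    case False
    with that obtain d where N: "N = Suc (m + d)" using less_iff_Suc_add[of m N] by auto
    have e: "N - m = Suc d" "N - Suc m = d" "N + Suc m = Suc (N + m)" "N + m + 1 = Suc (N + m)"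
      using N by simp_all
    have cm: "c m = 1 / (qpoch q q d * (1 - q * q ^ d) * qpoch q q (N + m))"
      unfolding c_def e using that by (simp add: qpoch_Suc)
    have cSm: "c (Suc m) = 1 / (qpoch q q d * (qpoch q q (N + m) * (1 - q * q ^ (N + m))))"
      unfolding c_def e using N by (simp add: qpoch_Suc)
    define P D Y where "P = qpoch q q (N + m)" and "D = q ^ d" and "Y = q ^ (2 * m)"
    have qNm: "q ^ (N + m) = q * D * Y"
      using N by (simp add: D_def Y_def mult_2 power_add)
    have nz2: "1 - q * D \<noteq> 0" "1 - q * (q * D * Y) \<noteq> 0" "P \<noteq> 0" "qpoch q q d \<noteq> 0"
      using power_Suc_neq_1(1)[OF q, of d] power_Suc_neq_1(1)[OF q, of "N + m"] nz
      unfolding qNm D_def P_def by auto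
    have Y: "q ^ (2 * m + 1) = q * Y" by (simp add: Y_def)
    have split: "1 - q * Y = (1 - q * (q * D * Y)) - q * Y * (1 - q * D)"
      by (simp add: algebra_simps)
    have frac: "(c - y * b) * x / (K * b * (L * c)) = x * (1 / (K * b * L)) - y * x * (1 / (K * (L * c)))"
      if "b \<noteq> 0" "c \<noteq> 0" for b c x y K L :: complex
      using that by (simp add: diff_divide_distrib left_diff_distrib)
    show ?thesis unfolding cm cSm e v_def qpoch_Suc qNm Y P_def[symmetric] D_def[symmetric] split
      by (rule frac[OF nz2(1,2)])
  qed
  then have "bailey_sum q 1 (\<lambda>m. (1 - q ^ (2 * m + 1)) * w m) N
      = (\<Sum>m\<le>N. w m * c m) - (\<Sum>m\<le>N. v m * c (Suc m))"
    unfolding bailey_sum_def sum_subtractf[symmetric] by (intro sum.cong) auto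
  also have "(\<Sum>m\<le>N. v m * c (Suc m)) = (\<Sum>m\<le>Suc N. if m = 0 then 0 else v (m - 1) * c m)"
    by (simp add: sum.atMost_Suc_shift del: sum.atMost_Suc)
  also have "\<dots> = (\<Sum>m\<le>N. if m = 0 then 0 else v (m - 1) * c m)"
    by (simp add: c_def)
  also have "(\<Sum>m\<le>N. w m * c m) - \<dots>
      = (\<Sum>m\<le>N. (w m - (if m = 0 then 0 else q ^ (2 * m - 1) * w (m - 1))) * c m)"
    unfolding sum_subtractf[symmetric]
  proof (intro sum.cong refl, goal_cases)
    case (1 m)
    then show ?case by (cases m) (simp_all add: v_def algebra_simps)
  qed
  also have "\<dots> = bailey_sum q 0 (\<lambda>m. w m - (if m = 0 then 0 else q ^ (2 * m - 1) * w (m - 1))) N"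
    unfolding bailey_sum_def by (intro sum.cong) (auto simp: c_def)
  finally show ?thesis .
qed

text \<open>
The terms of the two-sided series \<open>\<Sum> (-1)^m p^(m (m-1) / 2) z^m\<close> over all integers, with \<open>m\<close> and \<open>-m\<close>
combined; for \<open>z w = p\<close> the term at \<open>-m\<close> is the term at \<open>m\<close> with \<open>w\<close> in place of \<open>z\<close>. Folding in this way
avoids negative powers, so that \<open>q = 0\<close> needs no separate treatment.
\<close>

definition theta_coeff :: "complex \<Rightarrow> complex \<Rightarrow> complex \<Rightarrow> nat \<Rightarrow> complex" where
  "theta_coeff p z w m = (if m = 0 then 1 else (-1) ^ m * p ^ (m choose 2) * (z ^ m + w ^ m))"

text \<open>
The starting point of the Bailey chain. The partial sums over \<open>m \<le> M\<close> have a closed form, proved by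
induction on \<open>M\<close>; its factor \<open>1 - q^(n-M)\<close> makes the full sum vanish for \<open>n > 0\<close>.
\<close>

lemma unit_bailey_pair:
  assumes q: "norm q < 1"
  shows "bailey_sum q 0 (theta_coeff q 1 q) n = (if n = 0 then 1 else 0)"
proof (cases n)
  case 0
  then show ?thesis by (simp add: bailey_sum_def theta_coeff_def)
next
  case (Suc n')
  then have n1: "1 - q ^ n \<noteq> 0" using power_Suc_neq_1(2)[OF q] by blast
  note nz = qpoch_nonzero[OF q q]
  have "(\<Sum>m\<le>M. theta_coeff q 1 q m / (qpoch q q (n - m) * qpoch q q (n + m)))
      = (-1) ^ M * q ^ (Suc M choose 2) * (1 - q ^ (n - M)) /
          (qpoch q q (n - M) * qpoch q q (n + M) * (1 - q ^ n))" if "M \<le> n" for M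
    using that
  proof (induction M)
    case 0
    then show ?case using n1 nz[of n] by (simp add: theta_coeff_def choose_2_Suc binomial_eq_0 divide_simps)
  next
    case (Suc M)
    obtain d where d: "n = Suc (M + d)" using Suc.prems less_iff_Suc_add[of M n] by auto
    have e: "n - M = Suc d" "n - Suc M = d" "n + Suc M = Suc (n + M)" using d by simp_all
    \<comment> \<open>In terms of \<open>X\<close>, \<open>Y\<close> and \<open>D\<close> the step is an identity of rational functions.\<close>
    define X where "X = (-1) ^ M * q ^ (M choose 2) * q ^ M"
    define Y where "Y = q ^ M" define D where "D = q ^ d"
    have n: "q ^ n = q * Y * D" unfolding d Y_def D_def by (simp add: power_add)
    have nM: "q * q ^ (n + M) = q * q * Y * Y * D" unfolding power_add n Y_def by simp
    have nz2: "1 - q * D \<noteq> 0" "1 - q * q * Y * Y * D \<noteq> 0" "1 - q * Y * D \<noteq> 0"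
      using power_Suc_neq_1(1)[OF q, of d] power_Suc_neq_1(1)[OF q, of "n + M"] n1
      unfolding n nM D_def by auto
    have "(\<Sum>m\<le>Suc M. theta_coeff q 1 q m / (qpoch q q (n - m) * qpoch q q (n + m)))
       = X * (1 - q * D) / (qpoch q q d * (1 - q * D) * qpoch q q (n + M) * (1 - q * Y * D))
         - X * (1 + q * Y) / (qpoch q q d * (qpoch q q (n + M) * (1 - q * q * Y * Y * D)))"
      using Suc unfolding sum.atMost_Suc e qpoch_Suc n nM
      by (simp add: theta_coeff_def X_def Y_def D_def choose_2_Suc power_add)
    also have "\<dots> = - (X * q * Y * (1 - D)) /
         (qpoch q q d * (qpoch q q (n + M) * (1 - q * q * Y * Y * D)) * (1 - q * Y * D))"
      using nz2 nz[of d] nz[of "n + M"] by (simp add: divide_simps) (simp add: algebra_simps)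
    also have "\<dots> = (-1) ^ Suc M * q ^ (Suc (Suc M) choose 2) * (1 - q ^ (n - Suc M)) /
          (qpoch q q (n - Suc M) * qpoch q q (n + Suc M) * (1 - q ^ n))"
      unfolding e qpoch_Suc n nM by (simp add: X_def Y_def D_def choose_2_Suc power_add)
    finally show ?case .
  qed
  from this[of n] show ?thesis using Suc by (simp add: bailey_sum_def)
qed

section \<open>Finite forms of the Andrews-Gordon identities modulo 7\<close>

text \<open>
The exponent \<open>m^2 + 0 m\<close> is the weight of \<open>bailey_lemma\<close> for \<open>a = 0\<close>. Since \<open>m^2 = 2 (m choose 2) + m\<close>,
a step of the chain only changes the parameters of the theta terms.
\<close>

lemma q_power_mult_theta_coeff:
  "q ^ (m\<^sup>2 + 0 * m) * theta_coeff p z w m = theta_coeff (p * q\<^sup>2) (z * q) (w * q) m"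
  by (simp add: theta_coeff_def square_eq_choose_2 power_add power_mult power_mult_distrib algebra_simps binomial_eq_0)

text \<open>
The counterpart of the theta terms for parameter \<open>q\<close>: here the term at \<open>m\<close> of a two-sided series is
combined with the one at \<open>-m-1\<close>, whose weight \<open>m^2 + m\<close> is the same. The number \<open>c\<close> counts
the steps taken along the chain.
\<close>

definition folded_theta_coeff :: "complex \<Rightarrow> nat \<Rightarrow> nat \<Rightarrow> complex" where
  "folded_theta_coeff q c m = (1 - q ^ (2 * m + 1)) * ((-1) ^ m * q ^ ((m choose 2) + c * (m\<^sup>2 + m)))"

lemma q_power_mult_folded_theta_coeff:
  "q ^ (m\<^sup>2 + 1 * m) * folded_theta_coeff q c m = folded_theta_coeff q (Suc c) m"
  by (simp add: folded_theta_coeff_def power_add)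

text \<open>
The same two-sided series is folded about \<open>0\<close> on the right and about \<open>-1/2\<close> on the left: the difference
of neighbouring terms produced by \<open>bailey_sum_1_to_0\<close> is again a theta term.
\<close>

lemma bailey_sum_folded_theta_coeff:
  assumes q: "norm q < 1"
  shows "bailey_sum q 1 (folded_theta_coeff q c) N
       = bailey_sum q 0 (theta_coeff (q ^ (2 * c + 1)) (q ^ (2 * c)) q) N"
proof -
  define w where "w = (\<lambda>m. (-1) ^ m * q ^ ((m choose 2) + c * (m\<^sup>2 + m)))"
  have "w m - (if m = 0 then 0 else q ^ (2 * m - 1) * w (m - 1))
      = theta_coeff (q ^ (2 * c + 1)) (q ^ (2 * c)) q m" for m
  proof (cases m)
    case 0
    then show ?thesis by (simp add: w_def theta_coeff_def binomial_eq_0)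
  next
    case (Suc k)
    have e1: "(m choose 2) + c * (m\<^sup>2 + m) = (2 * c + 1) * (m choose 2) + 2 * c * m"
      unfolding square_eq_choose_2 by (simp add: algebra_simps)
    have e2: "2 * m - 1 + ((k choose 2) + c * (k\<^sup>2 + k)) = (2 * c + 1) * (m choose 2) + m"
      unfolding square_eq_choose_2 Suc choose_2_Suc by (simp add: algebra_simps)
    define X where "X = (-1) ^ m * (q ^ (2 * c + 1)) ^ (m choose 2)"
    have "q ^ (2 * m - 1) * w k = - ((-1) ^ m * q ^ (2 * m - 1 + ((k choose 2) + c * (k\<^sup>2 + k))))"
      unfolding w_def power_add by (simp add: Suc)
    then have wk: "q ^ (2 * m - 1) * w k = - (X * q ^ m)"
      unfolding e2 X_def by (simp only: power_add power_mult mult.assoc)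
    have wm: "w m = X * (q ^ (2 * c)) ^ m"
      unfolding w_def e1 X_def by (simp only: power_add power_mult mult.assoc)
    have "w m - q ^ (2 * m - 1) * w k = X * ((q ^ (2 * c)) ^ m + q ^ m)"
      unfolding wk wm by (simp add: distrib_left)
    then show ?thesis using Suc by (simp add: theta_coeff_def X_def)
  qed
  moreover have "folded_theta_coeff q c = (\<lambda>m. (1 - q ^ (2 * m + 1)) * w m)"
    by (simp add: fun_eq_iff folded_theta_coeff_def w_def)
  ultimately show ?thesis by (simp only: bailey_sum_1_to_0[OF q])
qed

text \<open>
The Andrews-Gordon double sum over \<open>t \<le> s\<close>, made finite by the factor \<open>1 / (q;q)\<close> with index \<open>N - s\<close>. As
\<open>N\<close> grows this factor tends to a constant, so the limit is the full double sum divided by the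
infinite product of all \<open>1 - q^m\<close>.
\<close>

definition andrews_gordon_sum :: "complex \<Rightarrow> nat \<Rightarrow> nat \<Rightarrow> nat \<Rightarrow> complex" where
  "andrews_gordon_sum q a b N = (\<Sum>s\<le>N. q ^ (s\<^sup>2 + a * s) / qpoch q q (N - s) *
      (\<Sum>t\<le>s. q ^ (t\<^sup>2 + b * t) / (qpoch q q (s - t) * qpoch q q t)))"

lemma bailey_sum_from_unit:
  assumes q: "norm q < 1" and unit: "\<And>n. bailey_sum q a \<alpha> n = (if n = 0 then 1 else 0)"
  shows "bailey_sum q a (\<lambda>m. q ^ (m\<^sup>2 + a * m) * \<alpha> m) N = 1 / qpoch q q N"
  unfolding bailey_lemma[OF q, where \<alpha> = \<alpha>, symmetric] unit by (simp add: if_distrib sum.delta cong: if_cong)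

text \<open>
Two steps from the unit pair turn \<open>\<beta>\<close> into the inner sum of \<open>andrews_gordon_sum\<close>; a third step adds the
outer sum.
\<close>

lemma bailey_sum_twice_from_unit:
  assumes q: "norm q < 1" and unit: "\<And>n. bailey_sum q a \<alpha> n = (if n = 0 then 1 else 0)"
  shows "(\<Sum>t\<le>s. q ^ (t\<^sup>2 + a * t) / (qpoch q q (s - t) * qpoch q q t))
       = bailey_sum q a (\<lambda>m. q ^ (m\<^sup>2 + a * m) * (q ^ (m\<^sup>2 + a * m) * \<alpha> m)) s"
  unfolding bailey_lemma[OF q, where \<alpha> = "\<lambda>m. q ^ (m\<^sup>2 + a * m) * \<alpha> m", symmetric]
    bailey_sum_from_unit[OF q unit] by simp

lemma folded_unit_bailey_pair:
  assumes q: "norm q < 1"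
  shows "bailey_sum q 1 (folded_theta_coeff q 0) n = (if n = 0 then 1 else 0)"
  using bailey_sum_folded_theta_coeff[OF q, of 0 n] unit_bailey_pair[OF q] by simp

text \<open>
For \<open>(a, b) = (0, 0)\<close> all three steps have parameter \<open>1\<close>, and for \<open>(1, 1)\<close> all three have parameter \<open>q\<close>, with
a change to \<open>1\<close> at the end. For \<open>(0, 1)\<close> the change of parameter takes place after two steps. In
all cases the resulting theta terms have \<open>p = q^7\<close>.
\<close>

lemma andrews_gordon_sum_eq_bailey_sum:
  assumes q: "norm q < 1"
  shows "andrews_gordon_sum q 0 0 N = bailey_sum q 0 (theta_coeff (q ^ 7) (q ^ 3) (q ^ 4)) N"
    and "andrews_gordon_sum q 0 1 N = bailey_sum q 0 (theta_coeff (q ^ 7) (q ^ 2) (q ^ 5)) N"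
    and "andrews_gordon_sum q 1 1 N = bailey_sum q 0 (theta_coeff (q ^ 7) q (q ^ 6)) N"
proof -
  have swap: "theta_coeff p z w = theta_coeff p w z" for p z w
    by (simp add: theta_coeff_def fun_eq_iff add.commute)
  have inner1: "(\<Sum>t\<le>s. q ^ (t\<^sup>2 + 1 * t) / (qpoch q q (s - t) * qpoch q q t))
       = bailey_sum q 1 (folded_theta_coeff q 2) s" for s
    unfolding bailey_sum_twice_from_unit[OF q folded_unit_bailey_pair[OF q]] q_power_mult_folded_theta_coeff
    by (simp add: numeral_2_eq_2)
  have powers: "q * q\<^sup>2 * q\<^sup>2 * q\<^sup>2 = q ^ 7" "1 * q * q * q = q ^ 3" "q * q * q * q = q ^ 4"
    by (simp_all add: eval_nat_numeral mult_ac)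
  have powers': "q ^ (2 * 2 + 1) * q\<^sup>2 = q ^ 7" "q ^ (2 * 2) * q = q ^ 5" "q * q = q ^ 2"
    by (simp_all add: eval_nat_numeral mult_ac)
  show "andrews_gordon_sum q 0 0 N = bailey_sum q 0 (theta_coeff (q ^ 7) (q ^ 3) (q ^ 4)) N"
    unfolding andrews_gordon_sum_def bailey_sum_twice_from_unit[OF q unit_bailey_pair[OF q]]
      bailey_lemma[OF q] q_power_mult_theta_coeff powers ..
  show "andrews_gordon_sum q 0 1 N = bailey_sum q 0 (theta_coeff (q ^ 7) (q ^ 2) (q ^ 5)) N"
    unfolding andrews_gordon_sum_def inner1 bailey_sum_folded_theta_coeff[OF q]
      bailey_lemma[OF q] q_power_mult_theta_coeff powers' by (subst swap) (rule refl)
  show "andrews_gordon_sum q 1 1 N = bailey_sum q 0 (theta_coeff (q ^ 7) q (q ^ 6)) N"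
    unfolding andrews_gordon_sum_def inner1 bailey_lemma[OF q] q_power_mult_folded_theta_coeff
    unfolding bailey_sum_folded_theta_coeff[OF q] by (subst swap) simp
qed

section \<open>The Jacobi triple product\<close>

definition two_sided_theta_coeff :: "complex \<Rightarrow> complex \<Rightarrow> complex \<Rightarrow> int \<Rightarrow> complex" where
  "two_sided_theta_coeff p z w m =
     (-1) ^ nat \<bar>m\<bar> * p ^ (nat \<bar>m\<bar> choose 2) * (if m \<ge> 0 then z ^ nat m else w ^ nat (- m))"

lemma two_sided_theta_coeff_of_nat:
  "two_sided_theta_coeff p z w (int m) = (-1) ^ m * p ^ (m choose 2) * z ^ m"
  "two_sided_theta_coeff p z w (- int m) = (-1) ^ m * p ^ (m choose 2) * w ^ m"
  by (simp_all add: two_sided_theta_coeff_def)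

text \<open>
Multiplication by \<open>z\<close> moves one place to the right in the two-sided series, and multiplication by \<open>w\<close> one
place to the left. The power \<open>p^N\<close> that comes with these factors in the finite products keeps the
exponents of \<open>p\<close> nonnegative on the range of \<open>k\<close> that occurs.
\<close>

lemma two_sided_theta_coeff_up:
  assumes zw: "z * w = p" and "k \<le> 2 * N"
  shows "z * p ^ N * two_sided_theta_coeff p z w (int k - int N)
       = - (p ^ (2 * N - k) * two_sided_theta_coeff p z w (int (Suc k) - int N))"
proof (cases "N \<le> k")
  case True
  then obtain d where k: "k = N + d" by (auto simp: le_iff_add)
  have "d \<le> N" using \<open>k \<le> 2 * N\<close> k by simp
  then obtain j where N: "N = d + j" by (auto simp: le_iff_add)
  have e: "int k - int N = int d" "int (Suc k) - int N = int (Suc d)" "2 * N - k = j" using k N by simp_all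
  show ?thesis unfolding e two_sided_theta_coeff_of_nat choose_2_Suc unfolding N
    by (simp add: power_add algebra_simps)
next
  case False
  then obtain d where N: "N = Suc (k + d)" using less_iff_Suc_add by (auto simp: not_le)
  have e: "int k - int N = - int (Suc d)" "int (Suc k) - int N = - int d" "2 * N - k = N + Suc d"
    using N by simp_all
  show ?thesis unfolding e two_sided_theta_coeff_of_nat choose_2_Suc zw[symmetric]
    by (simp add: power_add power_mult_distrib algebra_simps)
qed

lemma two_sided_theta_coeff_down:
  assumes zw: "z * w = p"
  shows "w * p ^ N * two_sided_theta_coeff p z w (int k - int N)
       = - (p ^ k * two_sided_theta_coeff p z w (int k - int (Suc N)))"
proof (cases "N < k")
  case True
  then obtain d where k: "k = Suc (N + d)" using less_iff_Suc_add by auto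
  have e: "int k - int N = int (Suc d)" "int k - int (Suc N) = int d" using k by simp_all
  show ?thesis unfolding e two_sided_theta_coeff_of_nat choose_2_Suc unfolding k zw[symmetric]
    by (simp add: power_add power_mult_distrib algebra_simps)
next
  case False
  then obtain d where N: "N = k + d" by (auto simp: not_less le_iff_add)
  have e: "int k - int N = - int d" "int k - int (Suc N) = - int (Suc d)" using N by simp_all
  show ?thesis unfolding e two_sided_theta_coeff_of_nat choose_2_Suc unfolding N
    by (simp add: power_add algebra_simps)
qed

text \<open>
The induction step multiplies by \<open>1 - z p^N\<close> and then by \<open>1 - w p^N\<close>. The first factor raises the upper
index of the q-binomial coefficients from \<open>2 N\<close> to \<open>2 N + 1\<close> by one q-Pascal rule, the second from \<open>2 N + 1\<close>
to \<open>2 N + 2\<close> by the other.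
\<close>

lemma finite_jacobi_triple_product:
  assumes p: "norm p < 1" and zw: "z * w = p"
  shows "qpoch z p N * qpoch w p N
       = (\<Sum>k\<le>2 * N. qbinom p (2 * N) k * two_sided_theta_coeff p z w (int k - int N))"
proof (induction N)
  case 0
  then show ?case using p by (simp add: qbinom_0_right two_sided_theta_coeff_def binomial_eq_0)
next
  case (Suc N)
  define h where "h = two_sided_theta_coeff p z w"
  define b where "b = qbinom p (2 * N)"
  define b' where "b' = qbinom p (Suc (2 * N))"
  note up = two_sided_theta_coeff_up[OF zw, folded h_def]
  note down = two_sided_theta_coeff_down[OF zw, folded h_def]
  have half: "(1 - z * p ^ N) * (\<Sum>k\<le>2 * N. b k * h (int k - int N))
      = (\<Sum>k\<le>Suc (2 * N). b' k * h (int k - int N))"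
  proof -
    have "(1 - z * p ^ N) * (\<Sum>k\<le>2 * N. b k * h (int k - int N))
        = (\<Sum>k\<le>2 * N. b k * h (int k - int N)) - (\<Sum>k\<le>2 * N. b k * (z * p ^ N * h (int k - int N)))"
      unfolding left_diff_distrib mult_1 sum_distrib_left by (simp add: sum_subtractf mult_ac)
    also have "(\<Sum>k\<le>2 * N. b k * (z * p ^ N * h (int k - int N)))
        = - (\<Sum>k\<le>2 * N. p ^ (2 * N - k) * b k * h (int (Suc k) - int N))"
      unfolding sum_negf[symmetric] by (rule sum.cong[OF refl]) (subst up, simp_all add: mult_ac)
    also have "(\<Sum>k\<le>2 * N. b k * h (int k - int N)) - - (\<Sum>k\<le>2 * N. p ^ (2 * N - k) * b k * h (int (Suc k) - int N))
        = h (- int N) + (\<Sum>k\<le>2 * N. b (Suc k) * h (int (Suc k) - int N))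
          + (\<Sum>k\<le>2 * N. p ^ (2 * N - k) * b k * h (int (Suc k) - int N))"
      unfolding b_def by (subst sum_qbinom_shift[OF p]) simp
    also have "h (- int N) + (\<Sum>k\<le>2 * N. b (Suc k) * h (int (Suc k) - int N))
          + (\<Sum>k\<le>2 * N. p ^ (2 * N - k) * b k * h (int (Suc k) - int N))
        = h (- int N) + (\<Sum>k\<le>2 * N. b' (Suc k) * h (int (Suc k) - int N))"
      unfolding b'_def b_def qbinom_Suc_Suc[OF p] distrib_right sum.distrib by simp
    also have "\<dots> = (\<Sum>k\<le>Suc (2 * N). b' k * h (int k - int N))"
      unfolding sum.atMost_Suc_shift by (simp add: b'_def qbinom_0_right[OF p])
    finally show ?thesis .
  qed
  have "(1 - w * p ^ N) * (\<Sum>k\<le>Suc (2 * N). b' k * h (int k - int N))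
      = (\<Sum>k\<le>Suc (2 * N). b' k * h (int k - int N)) - (\<Sum>k\<le>Suc (2 * N). b' k * (w * p ^ N * h (int k - int N)))"
    unfolding left_diff_distrib mult_1 sum_distrib_left by (simp add: sum_subtractf mult_ac del: sum.atMost_Suc)
  also have "(\<Sum>k\<le>Suc (2 * N). b' k * (w * p ^ N * h (int k - int N)))
      = - (\<Sum>k\<le>Suc (2 * N). b' k * (p ^ k * h (int k - int (Suc N))))"
    unfolding sum_negf[symmetric] down by (rule sum.cong[OF refl]) simp
  also have "(\<Sum>k\<le>Suc (2 * N). b' k * (p ^ k * h (int k - int (Suc N))))
      = h (- int (Suc N)) + (\<Sum>k\<le>Suc (2 * N). b' (Suc k) * (p ^ Suc k * h (int (Suc k) - int (Suc N))))"
    unfolding b'_def by (subst sum_qbinom_shift[OF p]) simp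
  also have "(\<Sum>k\<le>Suc (2 * N). b' k * h (int k - int N)) - - \<dots>
      = h (- int (Suc N)) + (\<Sum>k\<le>Suc (2 * N). qbinom p (Suc (Suc (2 * N))) (Suc k) * h (int (Suc k) - int (Suc N)))"
    unfolding qbinom_Suc_Suc'[OF p, of "Suc (2 * N)", folded b'_def] distrib_right sum.distrib
    by (simp add: mult_ac del: sum.atMost_Suc)
  also have "\<dots> = (\<Sum>k\<le>Suc (Suc (2 * N)). qbinom p (Suc (Suc (2 * N))) k * h (int k - int (Suc N)))"
    unfolding sum.atMost_Suc_shift[of _ "Suc (2 * N)"] by (simp add: qbinom_0_right[OF p] del: sum.atMost_Suc)
  finally have "(1 - w * p ^ N) * ((1 - z * p ^ N) * (\<Sum>k\<le>2 * N. b k * h (int k - int N)))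
      = (\<Sum>k\<le>2 * Suc N. qbinom p (2 * Suc N) k * h (int k - int (Suc N)))"
    unfolding half by simp
  then show ?case
    unfolding h_def b_def Suc[symmetric] qpoch_Suc by (simp only: mult_ac)
qed

lemma sum_fold_symmetric:
  fixes f :: "int \<Rightarrow> 'a :: ab_group_add"
  shows "(\<Sum>k\<le>2 * N. f (int k - int N)) = (\<Sum>m\<le>N. if m = 0 then f 0 else f (int m) + f (- int m))"
proof (induction N)
  case (Suc N)
  have "(\<Sum>k\<le>2 * Suc N. f (int k - int (Suc N)))
      = (\<Sum>k\<le>Suc (Suc (2 * N)). f (int k - int (Suc N)))" by simp
  also have "\<dots> = f (- int (Suc N)) + (\<Sum>k\<le>Suc (2 * N). f (int k - int N))"
    unfolding sum.atMost_Suc_shift[of _ "Suc (2 * N)"] by (simp del: sum.atMost_Suc)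
  also have "(\<Sum>k\<le>Suc (2 * N). f (int k - int N)) = (\<Sum>k\<le>2 * N. f (int k - int N)) + f (int (Suc N))"
    by (simp add: add.commute)
  finally show ?case unfolding Suc by (simp add: algebra_simps)
qed simp

text \<open>
Dividing the finite triple product by \<open>(p;p)\<close> with index \<open>2 N\<close> and folding it about its centre exhibits it as
a Bailey pair relative to \<open>1\<close>, so that the limit of \<open>bailey_sum\<close> evaluates the theta series.
\<close>

lemma finite_jacobi_triple_product_bailey:
  assumes p: "norm p < 1" and zw: "z * w = p"
  shows "bailey_sum p 0 (theta_coeff p z w) N = qpoch z p N * qpoch w p N / qpoch p p (2 * N)"
proof -
  note nz = qpoch_nonzero[OF p p]
  define f where "f = (\<lambda>m::int. two_sided_theta_coeff p z w m /
                        (qpoch p p (nat (int N + m)) * qpoch p p (nat (int N - m))))"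
  have "qpoch z p N * qpoch w p N / qpoch p p (2 * N) = (\<Sum>k\<le>2 * N. f (int k - int N))"
    unfolding finite_jacobi_triple_product[OF p zw] sum_divide_distrib
  proof (rule sum.cong[OF refl], goal_cases)
    case (1 k)
    then have "nat (int N + (int k - int N)) = k" "nat (int N - (int k - int N)) = 2 * N - k" by auto
    then show ?case using 1 nz[of "2 * N"] by (simp add: qbinom_def f_def)
  qed
  also have "\<dots> = (\<Sum>m\<le>N. if m = 0 then f 0 else f (int m) + f (- int m))"
    by (rule sum_fold_symmetric)
  also have "\<dots> = bailey_sum p 0 (theta_coeff p z w) N"
    unfolding bailey_sum_def
  proof (rule sum.cong[OF refl], goal_cases)
    case (1 m)
    then have "nat (int N + int m) = N + m" "nat (int N - int m) = N - m" by auto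
    moreover have "f 0 = 1 / (qpoch p p N * qpoch p p N)"
      by (simp add: f_def two_sided_theta_coeff_def binomial_eq_0)
    ultimately show ?case unfolding theta_coeff_def f_def two_sided_theta_coeff_of_nat
      by (simp add: algebra_simps add_divide_distrib two_sided_theta_coeff_def binomial_eq_0)
  qed
  finally show ?thesis ..
qed

section \<open>Passage to the limit\<close>

lemma
  assumes a: "norm a < 1" and q: "norm q < 1"
  shows qpoch_tendsto: "qpoch a q \<longlonglongrightarrow> qpoch_inf a q"
    and qpoch_inf_nonzero: "qpoch_inf a q \<noteq> 0"
proof -
  have nz: "1 - a * q ^ m \<noteq> 0" for m by (rule one_minus_mult_power_nonzero[OF a q])
  have "summable (\<lambda>m. norm a * norm q ^ m)"
    using q by (intro summable_mult summable_geometric) simp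
  then have "summable (\<lambda>m. norm (1 - a * q ^ m - 1))"
    by (simp add: norm_mult norm_power)
  then have conv: "convergent_prod (\<lambda>m. 1 - a * q ^ m)"
    by (intro abs_convergent_prod_imp_convergent_prod) (simp only: abs_convergent_prod_conv_summable)
  show "qpoch_inf a q \<noteq> 0"
    unfolding qpoch_inf_def by (rule prodinf_nonzero[OF conv nz])
  have "(\<lambda>n. qpoch a q (Suc n)) \<longlonglongrightarrow> qpoch_inf a q"
    using convergent_prod_LIMSEQ[OF conv] unfolding qpoch_def qpoch_inf_def lessThan_Suc_atMost .
  then show "qpoch a q \<longlonglongrightarrow> qpoch_inf a q"
    by (rule LIMSEQ_imp_Suc)
qed

lemma inverse_qpoch_tendsto:
  assumes "norm a < 1" "norm q < 1"
  shows "(\<lambda>n. 1 / qpoch a q n) \<longlonglongrightarrow> 1 / qpoch_inf a q"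
  by (intro tendsto_divide tendsto_const qpoch_tendsto qpoch_inf_nonzero assms)

lemma inverse_qpoch_bounded:
  assumes "norm a < 1" "norm q < 1"
  obtains K where "K > 0" "\<And>n. norm (1 / qpoch a q n) \<le> K"
  using Bseq_def convergent_imp_Bseq[OF convergentI[OF inverse_qpoch_tendsto[OF assms]]] by metis

text \<open>
Tannery's theorem applied to the weights \<open>u N m\<close>, cut off at \<open>m > N\<close>.
\<close>

lemma bounded_convergence_sums:
  fixes g :: "nat \<Rightarrow> complex"
  assumes g: "summable (\<lambda>m. norm (g m))"
    and lim: "\<And>m. (\<lambda>N. u N m) \<longlonglongrightarrow> L"
    and bound: "\<And>N m. norm (u N m) \<le> K"
  shows "(\<lambda>N. \<Sum>m\<le>N. g m * u N m) \<longlonglongrightarrow> (\<Sum>m. g m) * L"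
proof -
  define a where "a = (\<lambda>m N. if m \<le> N then g m * u N m else 0)"
  have K: "0 \<le> K" using bound[of 0 0] norm_ge_zero order_trans by blast
  have "(\<lambda>N. suminf (\<lambda>m. a m N)) \<longlonglongrightarrow> suminf (\<lambda>m. g m * L)"
  proof (rule tannerys_theorem[THEN conjunct2, THEN conjunct2])
    show "(\<lambda>N. a m N) \<longlonglongrightarrow> g m * L" for m
    proof (rule Lim_transform_eventually)
      show "(\<lambda>N. g m * u N m) \<longlonglongrightarrow> g m * L" by (intro tendsto_intros lim)
      show "\<forall>\<^sub>F N in sequentially. g m * u N m = a m N"
        using eventually_ge_at_top[of m] by eventually_elim (simp add: a_def)
    qed
    show "\<forall>\<^sub>F (m, N) in at_top \<times>\<^sub>F sequentially. norm (a m N) \<le> norm (g m) * K"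
      using K bound by (intro always_eventually) (auto simp: a_def norm_mult intro!: mult_left_mono)
    show "summable (\<lambda>m. norm (g m) * K)" using g by (rule summable_mult2)
  qed simp
  moreover have "suminf (\<lambda>m. a m N) = (\<Sum>m\<le>N. g m * u N m)" for N
    by (subst suminf_finite[of "{..N}"]) (auto simp: a_def)
  moreover have "suminf (\<lambda>m. g m * L) = (\<Sum>m. g m) * L"
    using summable_norm_cancel[OF g] by (rule suminf_mult2[symmetric])
  ultimately show ?thesis by simp
qed

lemma bailey_sum_tendsto:
  assumes q: "norm q < 1" and \<alpha>: "summable (\<lambda>m. norm (\<alpha> m))"
  shows "bailey_sum q 0 \<alpha> \<longlonglongrightarrow> (\<Sum>m. \<alpha> m) / (qpoch_inf q q)\<^sup>2"
proof -
  obtain K where K: "K > 0" "\<And>n. norm (1 / qpoch q q n) \<le> K"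
    using inverse_qpoch_bounded[OF q q] by blast
  note lim = inverse_qpoch_tendsto[OF q q]
  have "(\<lambda>N. \<Sum>m\<le>N. \<alpha> m * (1 / qpoch q q (N - m) * (1 / qpoch q q (N + m))))
      \<longlonglongrightarrow> (\<Sum>m. \<alpha> m) * (1 / qpoch_inf q q * (1 / qpoch_inf q q))"
  proof (rule bounded_convergence_sums[OF \<alpha>])
    show "(\<lambda>N. 1 / qpoch q q (N - m) * (1 / qpoch q q (N + m)))
        \<longlonglongrightarrow> 1 / qpoch_inf q q * (1 / qpoch_inf q q)" for m
      using filterlim_compose[OF lim filterlim_minus_const_nat_at_top[of m]]
            filterlim_compose[OF lim filterlim_add_const_nat_at_top[of m]]
      by (rule tendsto_mult)
    show "norm (1 / qpoch q q (N - m) * (1 / qpoch q q (N + m))) \<le> K * K" for N m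
      unfolding norm_mult using K by (intro mult_mono) (auto simp: less_imp_le)
  qed
  then show ?thesis
    unfolding bailey_sum_def by (simp add: power2_eq_square)
qed

lemma summable_norm_theta_coeff:
  assumes z: "norm z < 1" and w: "norm w < 1" and p: "norm p \<le> 1"
  shows "summable (\<lambda>m. norm (theta_coeff p z w m))"
proof (rule summable_comparison_test')
  show "summable (\<lambda>m. norm z ^ m + norm w ^ m)"
    using z w by (intro summable_add summable_geometric) simp_all
  show "norm (norm (theta_coeff p z w m)) \<le> norm z ^ m + norm w ^ m" if "0 \<le> m" for m
  proof (cases "m = 0")
    case False
    have "norm (theta_coeff p z w m) = norm p ^ (m choose 2) * norm (z ^ m + w ^ m)"
      using False by (simp add: theta_coeff_def norm_mult norm_power)
    also have "\<dots> \<le> 1 * norm (z ^ m + w ^ m)"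
      using p by (intro mult_right_mono power_le_one) simp_all
    also have "\<dots> \<le> norm z ^ m + norm w ^ m"
      using norm_triangle_ineq[of "z ^ m" "w ^ m"] by (simp add: norm_power)
    finally show ?thesis by simp
  qed (simp add: theta_coeff_def)
qed

lemma norm_mult_less_1:
  fixes z w :: complex
  assumes "norm z < 1" "norm w < 1"
  shows "norm (z * w) < 1"
  using assms mult_strict_mono'[of "norm z" 1 "norm w" 1] by (simp add: norm_mult)

text \<open>
Both sides, divided by the square of \<open>(p;p)\<close> with infinite index, are the limit of the finite identity.
\<close>

theorem jacobi_triple_product:
  assumes z: "norm z < 1" and w: "norm w < 1" and zw: "z * w = p"
  shows "(\<Sum>m. theta_coeff p z w m) = qpoch_inf z p * qpoch_inf w p * qpoch_inf p p"
proof -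
  have p: "norm p < 1" using norm_mult_less_1[OF z w] zw by simp
  note nz = qpoch_inf_nonzero[OF p p]
  have "(\<lambda>N. qpoch p p (2 * N)) \<longlonglongrightarrow> qpoch_inf p p"
    using LIMSEQ_subseq_LIMSEQ[OF qpoch_tendsto[OF p p], of "\<lambda>N. 2 * N"]
    by (simp add: strict_mono_def o_def)
  then have "(\<lambda>N. qpoch z p N * qpoch w p N / qpoch p p (2 * N))
      \<longlonglongrightarrow> qpoch_inf z p * qpoch_inf w p / qpoch_inf p p"
    by (intro tendsto_divide tendsto_mult qpoch_tendsto z w p nz)
  then have "bailey_sum p 0 (theta_coeff p z w) \<longlonglongrightarrow> qpoch_inf z p * qpoch_inf w p / qpoch_inf p p"
    unfolding finite_jacobi_triple_product_bailey[OF p zw, symmetric] .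
  moreover have "bailey_sum p 0 (theta_coeff p z w)
      \<longlonglongrightarrow> (\<Sum>m. theta_coeff p z w m) / (qpoch_inf p p)\<^sup>2"
    using p by (intro bailey_sum_tendsto summable_norm_theta_coeff z w) simp_all
  ultimately have "qpoch_inf z p * qpoch_inf w p / qpoch_inf p p
      = (\<Sum>m. theta_coeff p z w m) / (qpoch_inf p p)\<^sup>2"
    by (rule LIMSEQ_unique)
  then show ?thesis using nz by (simp add: field_simps power2_eq_square)
qed

section \<open>The triple sum\<close>

text \<open>
This is the coefficient of \<open>x^n\<close> in \<open>(-x;q) / (x^2;q^2) = 1 / (x;q)\<close> (infinite products), by Euler's expansions
of the three factors. Directly: writing \<open>1 - q^n = (1 - q^(2k)) + q^(2k) (1 - q^j)\<close> for
\<open>n = j + 2k\<close>, the first part lowers \<open>k\<close> and the second lowers \<open>j\<close>, so the sums \<open>A\<close> satisfy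
\<open>(1 - q^n) A(n) = A(n-2) + q^(n-1) A(n-1)\<close>, a recurrence that the right-hand side also satisfies.
\<close>

lemma sum_over_j_plus_2k:
  assumes q: "norm q < 1"
  shows "(\<Sum>k\<le>n div 2. q ^ ((n - 2 * k) choose 2) / (qpoch q q (n - 2 * k) * qpoch (q\<^sup>2) (q\<^sup>2) k))
       = 1 / qpoch q q n"
proof -
  define T where
    "T = (\<lambda>n k. q ^ ((n - 2 * k) choose 2) / (qpoch q q (n - 2 * k) * qpoch (q\<^sup>2) (q\<^sup>2) k))"
  have q2: "norm (q\<^sup>2) < 1" using q by (simp add: norm_power power_less_one_iff)
  note nz = qpoch_nonzero[OF q q] and nz2 = power_Suc_neq_1(2)[OF q2]
  have "(\<Sum>k\<le>n div 2. T n k) = 1 / qpoch q q n"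
  proof (induction n rule: induct_nat_012)
    case 0
    then show ?case by (simp add: T_def binomial_eq_0)
  next
    case 1
    then show ?case by (simp add: T_def binomial_eq_0)
  next
    case (ge2 n)
    \<comment> \<open>\<open>T n k\<close> is the term with \<open>j = n - 2k\<close>; one factor of a denominator is cancelled at a time.\<close>
    have remove_k: "(1 - q ^ (2 * Suc l)) * T (Suc (Suc n)) (Suc l) = T n l" for l
    proof -
      have "1 - q ^ (2 * Suc l) = 1 - q\<^sup>2 * (q\<^sup>2) ^ l"
        by (simp only: power_mult power_Suc)
      moreover have "Suc (Suc n) - 2 * Suc l = n - 2 * l" by simp
      ultimately show ?thesis using nz2[of l] unfolding T_def qpoch_Suc by simp
    qed
    have remove_j: "q ^ (2 * k) * (1 - q ^ (Suc (Suc n) - 2 * k)) * T (Suc (Suc n)) k = q ^ Suc n * T (Suc n) k"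
      if "k \<le> Suc n div 2" for k
    proof -
      define j where "j = Suc n - 2 * k"
      have e: "Suc (Suc n) - 2 * k = Suc j" "Suc n = 2 * k + j" using that by (auto simp: j_def)
      have "1 - q * q ^ j \<noteq> 0" using power_Suc_neq_1(1)[OF q] .
      then show ?thesis unfolding T_def e(1) j_def[symmetric] qpoch_Suc choose_2_Suc
        unfolding e(2) by (simp add: power_add)
    qed
    have "(1 - q ^ Suc (Suc n)) * (\<Sum>k\<le>Suc (Suc n) div 2. T (Suc (Suc n)) k)
        = (\<Sum>k\<le>Suc (Suc n) div 2. (1 - q ^ (2 * k)) * T (Suc (Suc n)) k
              + q ^ (2 * k) * (1 - q ^ (Suc (Suc n) - 2 * k)) * T (Suc (Suc n)) k)"
      unfolding sum_distrib_left
    proof (rule sum.cong[OF refl], goal_cases)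
      case (1 k)
      then have "q ^ (2 * k) * q ^ (Suc (Suc n) - 2 * k) = q ^ Suc (Suc n)"
        unfolding power_add[symmetric] by (auto simp: div_eq_0_iff)
      then show ?case by (simp only: right_diff_distrib left_diff_distrib mult_1 mult_1_right) simp
    qed
    also have "\<dots> = (\<Sum>k\<le>Suc (n div 2). (1 - q ^ (2 * k)) * T (Suc (Suc n)) k)
        + (\<Sum>k\<le>Suc (Suc n) div 2. q ^ (2 * k) * (1 - q ^ (Suc (Suc n) - 2 * k)) * T (Suc (Suc n)) k)"
      by (simp only: sum.distrib div2_Suc_Suc)
    also have "(\<Sum>k\<le>Suc (n div 2). (1 - q ^ (2 * k)) * T (Suc (Suc n)) k) = (\<Sum>l\<le>n div 2. T n l)"
      unfolding sum.atMost_Suc_shift remove_k by simp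
    also have "(\<Sum>k\<le>Suc (Suc n) div 2. q ^ (2 * k) * (1 - q ^ (Suc (Suc n) - 2 * k)) * T (Suc (Suc n)) k)
        = (\<Sum>k\<le>Suc n div 2. q ^ (2 * k) * (1 - q ^ (Suc (Suc n) - 2 * k)) * T (Suc (Suc n)) k)"
      \<comment> \<open>The ranges differ for even \<open>n\<close> only, by the term with \<open>j = 0\<close>, where \<open>1 - q^j\<close> vanishes.\<close>
    proof (rule sum.mono_neutral_right, simp, force, rule ballI, goal_cases)
      case (1 k)
      then have "Suc (Suc n) - 2 * k = 0" by auto
      then show ?case by simp
    qed
    also have "\<dots> = q ^ Suc n * (\<Sum>k\<le>Suc n div 2. T (Suc n) k)"
      unfolding sum_distrib_left by (rule sum.cong[OF refl], rule remove_j) simp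
    also have "(\<Sum>l\<le>n div 2. T n l) + q ^ Suc n * (\<Sum>k\<le>Suc n div 2. T (Suc n) k)
        = 1 / qpoch q q n + q ^ Suc n * (1 / qpoch q q (Suc n))"
      by (simp only: ge2)
    also have "\<dots> = 1 / qpoch q q (Suc n)"
      using power_Suc_neq_1(1)[OF q, of n] nz[of n] by (simp add: qpoch_Suc divide_simps)
    finally have "(1 - q ^ Suc (Suc n)) * (\<Sum>k\<le>Suc (Suc n) div 2. T (Suc (Suc n)) k) = 1 / qpoch q q (Suc n)" .
    moreover have "qpoch q q (Suc (Suc n)) = qpoch q q (Suc n) * (1 - q ^ Suc (Suc n))"
      by (simp add: qpoch_Suc)
    ultimately show ?case
      using power_Suc_neq_1(2)[OF q, of "Suc n"] nz[of "Suc n"] by (simp only: eq_divide_eq) (simp add: mult_ac)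
  qed
  then show ?thesis by (simp add: T_def)
qed

text \<open>
The exponents of the theorem, rewritten in terms of \<open>s = i + j + 2k\<close> and \<open>t = j + 2k\<close> as
\<open>(s^2 + a s) + (t^2 + b t) + (j choose 2)\<close>.
\<close>

definition triple_term :: "complex \<Rightarrow> nat \<Rightarrow> nat \<Rightarrow> nat \<times> nat \<times> nat \<Rightarrow> complex" where
  "triple_term q a b = (\<lambda>(i, j, k).
     q ^ (((i + j + 2 * k)\<^sup>2 + a * (i + j + 2 * k)) + ((j + 2 * k)\<^sup>2 + b * (j + 2 * k)) + (j choose 2))
       / (qpoch q q i * qpoch q q j * qpoch (q\<^sup>2) (q\<^sup>2) k))"

lemma summable_on_geometric_triple:
  fixes r :: real
  assumes "0 \<le> r" "r < 1"
  shows "(\<lambda>(i::nat, j::nat, k::nat). r ^ (i + j + k)) summable_on UNIV"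
proof -
  have geo: "((\<lambda>n. c * r ^ n) has_sum c * (1 / (1 - r))) UNIV" for c
    using assms by (intro has_sum_cmult_right norm_summable_imp_has_sum geometric_sums) (auto intro: summable_geometric)
  have 1: "((\<lambda>(j::nat, k::nat). r ^ j * r ^ k) has_sum (1 / (1 - r)) * (1 / (1 - r))) (UNIV \<times> UNIV)"
  proof (rule has_sum_SigmaI)
    show "((\<lambda>k. (case (j, k) of (j, k) \<Rightarrow> r ^ j * r ^ k)) has_sum r ^ j * (1 / (1 - r))) UNIV" for j
      using geo[of "r ^ j"] by simp
    show "((\<lambda>j. r ^ j * (1 / (1 - r))) has_sum (1 / (1 - r)) * (1 / (1 - r))) UNIV"
      using geo[of "1 / (1 - r)"] by (simp only: mult.commute)
    show "(\<lambda>(j, k). r ^ j * r ^ k) summable_on (UNIV \<times> UNIV)"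
      by (rule summable_on_SigmaI[where g = "\<lambda>j. r ^ j * (1 / (1 - r))"])
        (use geo geo[of "1 / (1 - r)", THEN has_sum_imp_summable] assms in \<open>auto simp: mult.commute\<close>)
  qed
  have "(\<lambda>(i::nat, jk). r ^ i * (case jk of (j, k) \<Rightarrow> r ^ j * r ^ k)) summable_on (UNIV \<times> UNIV)"
  proof (rule summable_on_SigmaI)
    show "((\<lambda>jk. (case (i, jk) of (i::nat, jk) \<Rightarrow> r ^ i * (case jk of (j::nat, k::nat) \<Rightarrow> r ^ j * r ^ k)))
        has_sum r ^ i * ((1 / (1 - r)) * (1 / (1 - r)))) UNIV" for i
      using has_sum_cmult_right[OF 1, of "r ^ i"] by simp
    show "(\<lambda>i. r ^ i * ((1 / (1 - r)) * (1 / (1 - r)))) summable_on UNIV"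
      using geo[of "(1 / (1 - r)) * (1 / (1 - r))", THEN has_sum_imp_summable] by (simp only: mult.commute)
  qed (use assms in auto)
  then show ?thesis by (simp add: case_prod_beta' power_add mult.assoc)
qed

text \<open>
The reciprocals of the finite products are bounded, and the exponent is at least
\<open>s^2 \<ge> s \<ge> i + j + k\<close>, so a triple geometric series dominates.
\<close>

lemma triple_term_summable:
  assumes q: "norm q < 1"
  shows "triple_term q a b summable_on UNIV"
proof -
  have q2: "norm (q\<^sup>2) < 1" using q by (simp add: norm_power power_less_one_iff)
  obtain K where K: "K > 0" "\<And>n. norm (1 / qpoch q q n) \<le> K"
    using inverse_qpoch_bounded[OF q q] by blast
  obtain K' where K': "K' > 0" "\<And>n. norm (1 / qpoch (q\<^sup>2) (q\<^sup>2) n) \<le> K'"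
    using inverse_qpoch_bounded[OF q2 q2] by blast
  have "(\<lambda>x. norm (triple_term q a b x)) summable_on UNIV"
  proof (rule summable_on_comparison_test)
    show "(\<lambda>x. K * K * K' * (case x of (i::nat, j::nat, k::nat) \<Rightarrow> norm q ^ (i + j + k))) summable_on UNIV"
      using q by (intro summable_on_cmult_right summable_on_geometric_triple) simp_all
    show "norm (triple_term q a b x) \<le> K * K * K' * (case x of (i, j, k) \<Rightarrow> norm q ^ (i + j + k))" for x
    proof (cases x)
      case (fields i j k)
      define e where "e = ((i + j + 2 * k)\<^sup>2 + a * (i + j + 2 * k)) + ((j + 2 * k)\<^sup>2 + b * (j + 2 * k)) + (j choose 2)"
      have "i + j + 2 * k \<le> (i + j + 2 * k)\<^sup>2"
        by (rule power2_nat_le_imp_le) simp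
      then have "i + j + k \<le> e" unfolding e_def by linarith
      then have "norm q ^ e \<le> norm q ^ (i + j + k)"
        using q by (intro power_decreasing) simp_all
      then have "norm (1 / qpoch q q i) * norm (1 / qpoch q q j) * norm (1 / qpoch (q\<^sup>2) (q\<^sup>2) k) * norm q ^ e
          \<le> K * K * K' * norm q ^ (i + j + k)"
        using K K' by (intro mult_mono) (auto simp: less_imp_le)
      also have "norm (1 / qpoch q q i) * norm (1 / qpoch q q j) * norm (1 / qpoch (q\<^sup>2) (q\<^sup>2) k) * norm q ^ e
          = norm (triple_term q a b x)"
        unfolding triple_term_def fields by (simp add: norm_mult norm_divide norm_power e_def)
      finally show ?thesis by (simp add: fields)
    qed
  qed simp
  then show ?thesis by (rule abs_summable_summable)
qed

text \<open>
The triples with \<open>i + j + 2k = s\<close> are parametrised by \<open>t = j + 2k\<close> and \<open>k\<close>; for fixed \<open>t\<close>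
the sum over \<open>k\<close> is the one of \<open>sum_over_j_plus_2k\<close>, and a term of the Andrews-Gordon sum remains.
\<close>

lemma triple_term_fibre_sum:
  assumes q: "norm q < 1"
  shows "(\<Sum>(t, k)\<in>(SIGMA t:{..s}. {..t div 2}). triple_term q a b (s - t, t - 2 * k, k))
       = q ^ (s\<^sup>2 + a * s) * (\<Sum>t\<le>s. q ^ (t\<^sup>2 + b * t) / (qpoch q q (s - t) * qpoch q q t))"
proof -
  have "(\<Sum>(t, k)\<in>(SIGMA t:{..s}. {..t div 2}). triple_term q a b (s - t, t - 2 * k, k))
      = (\<Sum>t\<le>s. \<Sum>k\<le>t div 2. triple_term q a b (s - t, t - 2 * k, k))"
    by (rule sum.Sigma[symmetric]) simp_all
  also have "\<dots> = (\<Sum>t\<le>s. q ^ (s\<^sup>2 + a * s) * (q ^ (t\<^sup>2 + b * t) / qpoch q q (s - t)) *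
      (\<Sum>k\<le>t div 2. q ^ ((t - 2 * k) choose 2) / (qpoch q q (t - 2 * k) * qpoch (q\<^sup>2) (q\<^sup>2) k)))"
    unfolding sum_distrib_left
  proof (intro sum.cong refl, goal_cases)
    case (1 t k)
    then have "s - t + (t - 2 * k) + 2 * k = s" "t - 2 * k + 2 * k = t" by auto
    then show ?case by (simp add: triple_term_def power_add)
  qed
  also have "\<dots> = q ^ (s\<^sup>2 + a * s) * (\<Sum>t\<le>s. q ^ (t\<^sup>2 + b * t) / (qpoch q q (s - t) * qpoch q q t))"
    unfolding sum_over_j_plus_2k[OF q] sum_distrib_left by (simp add: mult.assoc)
  finally show ?thesis .
qed

text \<open>
Absolute convergence allows the triple sum \<open>S\<close> to be computed along the fibres of \<open>s = i + j + 2k\<close>. The sequence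
\<open>andrews_gordon_sum\<close> then tends to \<open>S / P\<close>, where \<open>P\<close> is \<open>(q;q)\<close> with infinite index, whereas its form as a
\<open>bailey_sum\<close> tends to the theta series divided by \<open>P^2\<close>; the triple product evaluates that series.
\<close>

lemma triple_sum_eq_product:
  assumes q: "norm q < 1" and z: "norm z < 1" and w: "norm w < 1" and zw: "z * w = p"
    and ag: "\<And>N. andrews_gordon_sum q a b N = bailey_sum q 0 (theta_coeff p z w) N"
  shows "(triple_term q a b has_sum (qpochs_inf [z, w, p] p / qpoch_inf q q)) UNIV"
proof -
  have p: "norm p < 1" using norm_mult_less_1[OF z w] zw by simp
  define S where "S = infsum (triple_term q a b) UNIV"
  define g where "g = (\<lambda>s. q ^ (s\<^sup>2 + a * s) * (\<Sum>t\<le>s. q ^ (t\<^sup>2 + b * t) / (qpoch q q (s - t) * qpoch q q t)))"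
  have S: "(triple_term q a b has_sum S) UNIV"
    unfolding S_def by (intro has_sum_infsum triple_term_summable q)
  have bij: "bij_betw (\<lambda>(s, t, k). (s - t, t - 2 * k, k))
      (SIGMA s:UNIV. SIGMA t:{..s}. {..t div 2}) (UNIV :: (nat \<times> nat \<times> nat) set)"
    by (rule bij_betw_byWitness[where f' = "\<lambda>(i, j, k). (i + j + 2 * k, j + 2 * k, k)"]) auto
  have "((\<lambda>x. triple_term q a b (case x of (s, t, k) \<Rightarrow> (s - t, t - 2 * k, k))) has_sum S)
      (SIGMA s:UNIV. SIGMA t:{..s}. {..t div 2})"
    using S has_sum_reindex_bij_betw[OF bij] by blast
  then have g: "(g has_sum S) UNIV"
  proof (rule has_sum_SigmaD)
    show "((\<lambda>y. triple_term q a b (case (s, y) of (s, t, k) \<Rightarrow> (s - t, t - 2 * k, k))) has_sum g s)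
        (SIGMA t:{..s}. {..t div 2})" for s
      unfolding g_def triple_term_fibre_sum[OF q, symmetric]
      by (intro has_sum_finiteI) (auto intro!: sum.cong)
  qed
  then have "g summable_on UNIV" by (rule has_sum_imp_summable)
  then have g': "summable (\<lambda>s. norm (g s))"
    by (simp only: summable_on_iff_abs_summable_on_complex summable_on_imp_summable)
  obtain K where K: "K > 0" "\<And>n. norm (1 / qpoch q q n) \<le> K"
    using inverse_qpoch_bounded[OF q q] by blast
  have "(\<lambda>N. \<Sum>s\<le>N. g s * (1 / qpoch q q (N - s))) \<longlonglongrightarrow> (\<Sum>s. g s) * (1 / qpoch_inf q q)"
    by (rule bounded_convergence_sums[OF g' _ K(2)])
      (rule filterlim_compose[OF inverse_qpoch_tendsto[OF q q] filterlim_minus_const_nat_at_top])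
  moreover have "(\<Sum>s\<le>N. g s * (1 / qpoch q q (N - s))) = andrews_gordon_sum q a b N" for N
    unfolding andrews_gordon_sum_def g_def by (simp add: mult_ac)
  moreover have "(\<Sum>s. g s) = S" using has_sum_imp_sums[OF g] by (rule sums_unique[symmetric])
  ultimately have "bailey_sum q 0 (theta_coeff p z w) \<longlonglongrightarrow> S * (1 / qpoch_inf q q)"
    by (simp add: ag)
  moreover have "bailey_sum q 0 (theta_coeff p z w)
      \<longlonglongrightarrow> (\<Sum>m. theta_coeff p z w m) / (qpoch_inf q q)\<^sup>2"
    using p by (intro bailey_sum_tendsto summable_norm_theta_coeff z w q) simp_all
  ultimately have "S * (1 / qpoch_inf q q) = (\<Sum>m. theta_coeff p z w m) / (qpoch_inf q q)\<^sup>2"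
    by (rule LIMSEQ_unique)
  then have "S = (\<Sum>m. theta_coeff p z w m) / qpoch_inf q q"
    using qpoch_inf_nonzero[OF q q] by (simp add: field_simps power2_eq_square)
  also have "\<dots> = qpochs_inf [z, w, p] p / qpoch_inf q q"
    unfolding jacobi_triple_product[OF z w zw] by (simp add: qpochs_inf_def mult.assoc)
  finally show ?thesis using S by simp
qed

lemma half_exponents:
  shows "(5 * j\<^sup>2 - j) div 2 = 2 * j\<^sup>2 + (j choose 2)"
    and "(5 * j\<^sup>2 + j) div 2 = 2 * j\<^sup>2 + j + (j choose 2)"
    and "(5 * j\<^sup>2 + 3 * j) div 2 = 2 * j\<^sup>2 + 2 * j + (j choose 2)"
  by (simp_all add: square_eq_choose_2)

theorem theorem3p14:
  fixes q :: complex
  assumes "norm q < 1"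
  shows
    "((\<lambda>(i::nat, j::nat, k::nat).
         q ^ (i\<^sup>2 + (5 * j\<^sup>2 - j) div 2 + 8 * k\<^sup>2 + 2 * i * j + 4 * i * k + 8 * j * k)
           / (qpoch q q i * qpoch q q j * qpoch (q\<^sup>2) (q\<^sup>2) k))
       has_sum (qpochs_inf [q ^ 3, q ^ 4, q ^ 7] (q ^ 7) / qpoch_inf q q)) UNIV
     \<and>
     ((\<lambda>(i::nat, j::nat, k::nat).
         q ^ (i\<^sup>2 + (5 * j\<^sup>2 + j) div 2 + 8 * k\<^sup>2 + 2 * i * j + 4 * i * k + 8 * j * k + 2 * k)
           / (qpoch q q i * qpoch q q j * qpoch (q\<^sup>2) (q\<^sup>2) k))
       has_sum (qpochs_inf [q ^ 2, q ^ 5, q ^ 7] (q ^ 7) / qpoch_inf q q)) UNIV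
     \<and>
     ((\<lambda>(i::nat, j::nat, k::nat).
         q ^ (i\<^sup>2 + (5 * j\<^sup>2 + 3 * j) div 2 + 8 * k\<^sup>2 + 2 * i * j + 4 * i * k + 8 * j * k + i + 4 * k)
           / (qpoch q q i * qpoch q q j * qpoch (q\<^sup>2) (q\<^sup>2) k))
       has_sum (qpochs_inf [q, q ^ 6, q ^ 7] (q ^ 7) / qpoch_inf q q)) UNIV"
proof -
  note q = assms
  have small: "norm (q ^ n) < 1" if "0 < n" for n
    using q that by (simp add: norm_power power_less_one_iff)
  have zw: "q ^ 3 * q ^ 4 = q ^ 7" "q ^ 2 * q ^ 5 = q ^ 7" "q * q ^ 6 = q ^ 7"
    by (simp_all flip: power_add power_Suc)
  have exponents:
    "i\<^sup>2 + (5 * j\<^sup>2 - j) div 2 + 8 * k\<^sup>2 + 2 * i * j + 4 * i * k + 8 * j * k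
       = ((i + j + 2 * k)\<^sup>2 + 0 * (i + j + 2 * k)) + ((j + 2 * k)\<^sup>2 + 0 * (j + 2 * k)) + (j choose 2)"
    "i\<^sup>2 + (5 * j\<^sup>2 + j) div 2 + 8 * k\<^sup>2 + 2 * i * j + 4 * i * k + 8 * j * k + 2 * k
       = ((i + j + 2 * k)\<^sup>2 + 0 * (i + j + 2 * k)) + ((j + 2 * k)\<^sup>2 + 1 * (j + 2 * k)) + (j choose 2)"
    "i\<^sup>2 + (5 * j\<^sup>2 + 3 * j) div 2 + 8 * k\<^sup>2 + 2 * i * j + 4 * i * k + 8 * j * k + i + 4 * k
       = ((i + j + 2 * k)\<^sup>2 + 1 * (i + j + 2 * k)) + ((j + 2 * k)\<^sup>2 + 1 * (j + 2 * k)) + (j choose 2)"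
    for i j k :: nat
    unfolding half_exponents by (simp_all add: power2_eq_square algebra_simps)
  show ?thesis
    unfolding exponents triple_term_def[symmetric]
    by (intro conjI triple_sum_eq_product andrews_gordon_sum_eq_bailey_sum zw small q) simp_all
qed

end
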